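(* Let $\mathbb{F}$ be a field with characteristic $p$ (with the convention $p=\infty$ if the identity has infinite additive order), and let $A$ and $B$ be two finite nonempty subsets of $\mathbb{F}$. Let $P(x,y)\in\mathbb{F}[x,y]$ be a polynomial of degree $d=\deg P(x,y)$ such that for some integers $i\in[0,|A|-1]$ and $j\in[0,|B|-1]$ we have $\hat P(i,d-i)\neq 0$ and $\hat P(d-j,j)\neq 0$. Let $P_0(x,y)$ be the homogeneous polynomial of degree $d$ such that $P(x,y)=P_0(x,y)+R(x,y)$ for some $R(x,y)\in\mathbb{F}[x,y]$ with $\deg R(x,y)<d$, and put $P^*(x)=P_0(x,1)$. Let $$C=\{a+b : a\in A,\ b\in B,\ \text{and}\ P(a,b)\neq 0\}.$$ Then $$|C|\ge\min\{p-m_{P^*}(-1),\ |A|+|B|-1-d-N(P^* )\}.$$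
   Context: The characteristic of a field $\mathbb{F}$ is defined here as the additive order of its multiplicative identity; it is either a prime or $\infty$ (so $p=\infty$ corresponds to what is usually called characteristic $0$, and in that case $p-m=\infty$ for any integer $m$). Set $\mathcal{P}(p)=\{1,p,p^2,\ldots\}$ if $p<\infty$, and $\mathcal{P}(p)=\{1\}$ if $p=\infty$. $\deg P(x,y)$ is the total degree; the zero polynomial is regarded as having degree less than every nonnegative integer. $\hat P(i,j)$ denotes the coefficient of $x^iy^j$ in $P(x,y)$ (it is $0$ if $i$ or $j$ is negative). Let $\mathbb{E}$ be the algebraic closure of $\mathbb{F}$ and $\mathbb{E}^{\times}=\mathbb{E}\setminus\{0\}$; a polynomial $f(x)\in\mathbb{F}[x]$ is viewed as a polynomial over $\mathbb{E}$. For nonzero $f$ and $\alpha\in\mathbb{E}$, $m_f(\alpha)$ denotes the multiplicity of $\alpha$ with respect to $f$, i.e. the integer $m\ge 0$ such that $(x-\alpha)^m\mid f(x)$ but $(x-\alpha)^{m+1}\nmid f(x)$ (so $m_f(\alpha)=0$ if $\alpha$ is not a root). Define $$N(f)=\max_{q\in\mathcal{P}(p)} q\,|\{\alpha\in\mathbb{E}^{\times}\setminus\{-1\}: m_f(\alpha)\ge q\}|.$$ *)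

theory Defs
  imports "HOL-Algebra.Algebraic_Closure_Type" "HOL-Library.Extended_Real"
begin

text \<open>
  Polynomials in \<open>x\<close> and \<open>y\<close> over \<open>'a\<close> are elements of \<^typ>\<open>'a poly poly\<close>: the outer variable is \<open>y\<close>
  and the coefficients are polynomials in \<open>x\<close>. So \<open>P(a,b)\<close> is \<open>poly (poly P [:b:]) a\<close>, and
  \<open>P(x,1)\<close> is \<open>poly P 1\<close>.
\<close>

definition coeff2 :: "'a::zero poly poly \<Rightarrow> int \<Rightarrow> int \<Rightarrow> 'a" where
  "coeff2 P i j =
     (if i < 0 \<or> j < 0 then 0 else Polynomial.coeff (Polynomial.coeff P (nat j)) (nat i))"

definition poly2 :: "'a::comm_ring_1 poly poly \<Rightarrow> 'a \<Rightarrow> 'a \<Rightarrow> 'a" where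
  "poly2 P a b = poly (poly P [:b:]) a"

text \<open>The value \<open>-1\<close> makes the degree of the zero polynomial smaller than every natural number.\<close>

definition total_degree :: "'a::zero poly poly \<Rightarrow> int" where
  "total_degree P = (if P = 0 then -1 else Max {i + j | i j. coeff2 P i j \<noteq> 0})"

definition homogeneous2 :: "nat \<Rightarrow> 'a::zero poly poly \<Rightarrow> bool" where
  "homogeneous2 d P \<longleftrightarrow> (\<forall>i j. coeff2 P i j \<noteq> 0 \<longrightarrow> i + j = int d)"

text \<open>
  The additive order of \<open>1\<close>. It differs from \<^term>\<open>CHAR('a::field)\<close>, which is \<open>0\<close> if that order is infinite.
\<close>

definition field_characteristic :: "'a::field itself \<Rightarrow> enat" where
  "field_characteristic _ = (if CHAR('a) = 0 then \<infinity> else enat CHAR('a))"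

definition char_powers :: "enat \<Rightarrow> nat set" where
  "char_powers p = (case p of enat n \<Rightarrow> range (\<lambda>k. n ^ k) | \<infinity> \<Rightarrow> {1})"

definition closure_mult :: "'a::field poly \<Rightarrow> 'a alg_closure \<Rightarrow> nat" where
  "closure_mult f \<alpha> = Polynomial.order \<alpha> (map_poly to_ac f)"

text \<open>
  Meaningful for nonzero \<open>f\<close> only: then the maximum is over a finite set, as shown below, even
  though there can be infinitely many \<open>q\<close>.
\<close>

definition N_max :: "'a::field poly \<Rightarrow> nat" where
  "N_max f = Max ((\<lambda>q. q * card {\<alpha>. \<alpha> \<noteq> 0 \<and> \<alpha> \<noteq> -1 \<and> closure_mult f \<alpha> \<ge> q})
                  ` char_powers (field_characteristic TYPE('a)))"

lemma finite_coeff2_support: "finite {(i, j). coeff2 P i j \<noteq> 0}"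
proof (rule finite_subset)
  let ?T = "SIGMA j:{..Polynomial.degree P}. {..Polynomial.degree (Polynomial.coeff P j)}"
  show "{(i, j). coeff2 P i j \<noteq> 0} \<subseteq> (\<lambda>(j, i). (int i, int j)) ` ?T"
  proof clarify
    fix i j assume "coeff2 P i j \<noteq> 0"
    then have ij: "i \<ge> 0" "j \<ge> 0"
      and nz: "Polynomial.coeff (Polynomial.coeff P (nat j)) (nat i) \<noteq> 0"
      by (auto simp: coeff2_def split: if_splits)
    have "nat i \<le> Polynomial.degree (Polynomial.coeff P (nat j))"
      using nz by (rule Polynomial.le_degree)
    moreover from nz have "Polynomial.coeff P (nat j) \<noteq> 0" by auto
    then have "nat j \<le> Polynomial.degree P" by (rule Polynomial.le_degree)
    ultimately show "(i, j) \<in> (\<lambda>(j, i). (int i, int j)) ` ?T"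
      using ij by (intro image_eqI[of _ _ "(nat j, nat i)"]) auto
  qed
  show "finite ((\<lambda>(j, i). (int i, int j)) ` ?T)" by auto
qed

lemma finite_total_degree_set: "finite {i + j | i j. coeff2 P i j \<noteq> 0}"
proof -
  have "{i + j | i j. coeff2 P i j \<noteq> 0} = (\<lambda>(i, j). i + j) ` {(i, j). coeff2 P i j \<noteq> 0}"
    by auto
  then show ?thesis using finite_coeff2_support[of P] by simp
qed

lemma char_powers_pos: "q \<in> char_powers (field_characteristic TYPE('a::field)) \<Longrightarrow> q > 0"
  by (auto simp: char_powers_def field_characteristic_def split: if_splits)

lemma finite_N_max_set:
  fixes f :: "'a::field poly"
  assumes "f \<noteq> 0"
  shows "finite ((\<lambda>q. q * card {\<alpha>. \<alpha> \<noteq> 0 \<and> \<alpha> \<noteq> -1 \<and> closure_mult f \<alpha> \<ge> q})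
                  ` char_powers (field_characteristic TYPE('a)))"
proof -
  let ?g = "map_poly to_ac f"
  let ?S = "\<lambda>q. {\<alpha>. \<alpha> \<noteq> 0 \<and> \<alpha> \<noteq> -1 \<and> closure_mult f \<alpha> \<ge> q}"
  have g: "?g \<noteq> 0"
    using assms by (metis leading_coeff_0_iff to_ac_eq_0_iff coeff_map_poly to_ac_0 coeff_0)
  have le: "closure_mult f \<alpha> \<le> Polynomial.degree ?g" for \<alpha>
    unfolding closure_mult_def using g by (rule order_degree)
  have fin: "finite {\<alpha>. poly ?g \<alpha> = 0}" using g by (rule poly_roots_finite)
  have "q * card (?S q) \<le> Polynomial.degree ?g * card {\<alpha>. poly ?g \<alpha> = 0}"
    if "q \<in> char_powers (field_characteristic TYPE('a))" for q
  proof (cases "q \<le> Polynomial.degree ?g")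
    case True
    have "?S q \<subseteq> {\<alpha>. poly ?g \<alpha> = 0}"
      using char_powers_pos[OF that] g by (auto simp: closure_mult_def order_root)
    then show ?thesis using True fin by (intro mult_le_mono card_mono)
  next
    case False
    then have "\<not> q \<le> closure_mult f \<alpha>" for \<alpha> using le[of \<alpha>] by linarith
    then have "?S q = {}" by blast
    then show ?thesis by (simp only: card.empty mult_0_right zero_le)
  qed
  then show ?thesis
    by (intro finite_subset[OF _ finite_atMost[of "Polynomial.degree ?g * card {\<alpha>. poly ?g \<alpha> = 0}"]]) auto
qed

end

theory Submission
  imports Defs
begin

text \<open>
  Let \<open>n = |C|\<close>. The polynomial \<open>P(x,y) \<Prod>\<^bsub>c\<in>C\<^esub> (x + y - c)\<close> vanishes on \<open>A \<times> B\<close>, and its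
  homogeneous part of degree \<open>d + n\<close> becomes \<open>F(x) = P\<^sup>*(x) (1 + x)\<^sup>n\<close> at \<open>y = 1\<close>. By the
  combinatorial Nullstellensatz (\<open>nullstellensatz2\<close>), the coefficient of \<open>x\<^sup>s\<close> in \<open>F\<close> is zero whenever
  \<open>s < |A|\<close> and \<open>d + n - s < |B|\<close>. The claim is clear if \<open>d + n \<ge> |A| + |B|\<close>. Otherwise all
  coefficients strictly between \<open>d + n - |B|\<close> and \<open>|A|\<close> vanish, and the two nonvanishing hypotheses on
  \<open>P\<close> force \<open>F\<close> to have terms on both sides of this window.

  A polynomial with such a window cannot have too few roots. This is the heart of the proof
  (\<open>gap_le_multiplicity_count\<close>): the distance of two exponents with no terms strictly between them
  is at most \<open>q |{\<alpha> \<noteq> 0. m\<^sub>F(\<alpha>) \<ge> q}|\<close> for some \<open>q \<in> {1, p, p\<^sup>2, \<dots>}\<close>. Either there are enough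
  distinct roots, which is \<open>q = 1\<close>, or the low part of \<open>F\<close> has the same logarithmic derivative as
  \<open>F\<close>. The latter needs \<open>p < \<infinity>\<close>; then the quotient of the two is a \<open>p\<close>-th power, and the claim
  descends to a polynomial of smaller degree.

  The factor \<open>(1 + x)\<^sup>n\<close> changes multiplicities at \<open>-1\<close> only, and \<open>m\<^sub>F(-1) = m\<^bsub>P*\<^esub>(-1) + n\<close>. If
  \<open>n \<ge> p - m\<^bsub>P*\<^esub>(-1)\<close>, the theorem holds. Otherwise \<open>-1\<close> is counted for \<open>q = 1\<close> at most, hence
  \<open>|A| + |B| - d - n \<le> N(P\<^sup>*) + 1\<close> (\<open>card_restricted_sumset_ge\<close>).
\<close>

section \<open>Polynomials with a gap\<close>

text \<open>
  A root of multiplicity \<open>m\<close> is a root of the derivative of multiplicity at least \<open>m - 1\<close>, whatever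
  the characteristic, and the product restores the missing factor.
\<close>

lemma dvd_prod_roots_mult_pderiv:
  fixes f :: "'a::alg_closed_field poly"
  assumes "f \<noteq> 0" "finite T" "{\<alpha>. poly f \<alpha> = 0} \<subseteq> T"
  shows "f dvd (\<Prod>\<alpha>\<in>T. [:-\<alpha>, 1:]) * pderiv f"
  using assms
proof (induction "Polynomial.degree f" arbitrary: f rule: less_induct)
  case (less f)
  let ?R = "\<Prod>\<alpha>\<in>T. [:-\<alpha>, 1:]"
  show ?case
  proof (cases "Polynomial.degree f = 0")
    case True
    then obtain c where "f = [:c:]" by (rule degree_eq_zeroE)
    then show ?thesis by simp
  next
    case False
    then obtain \<alpha> where "poly f \<alpha> = 0"
      using alg_closed_imp_poly_has_root[of f] by auto
    then obtain g where g: "f = [:-\<alpha>, 1:] * g"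
      by (auto simp: poly_eq_0_iff_dvd elim: dvdE)
    have "g \<noteq> 0" using less.prems g by auto
    moreover have "Polynomial.degree g < Polynomial.degree f"
      unfolding g using \<open>g \<noteq> 0\<close> by (subst degree_mult_eq) auto
    ultimately have "g dvd ?R * pderiv g"
      using less.prems by (intro less.hyps) (auto simp: g)
    moreover have "[:-\<alpha>, 1:] dvd ?R"
      using less.prems \<open>poly f \<alpha> = 0\<close> by (intro dvd_prodI) auto
    moreover have "?R * pderiv f = ?R * g + [:-\<alpha>, 1:] * (?R * pderiv g)"
      unfolding g pderiv_mult by (simp add: pderiv_pCons algebra_simps)
    ultimately show ?thesis
      using dvd_add[OF mult_dvd_mono[of "[:-\<alpha>, 1:]" ?R g g] mult_dvd_mono[of "[:-\<alpha>, 1:]" "[:-\<alpha>, 1:]" g "?R * pderiv g"]]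
      by (simp only: g dvd_refl)
  qed
qed

text \<open>
  A vanishing derivative leaves only exponents divisible by \<open>p\<close>. As every coefficient has a \<open>p\<close>-th
  root, additivity of \<open>x \<mapsto> x\<^sup>p\<close> allows taking the root term by term.
\<close>

lemma pderiv_eq_0_imp_CHAR_power:
  fixes u :: "'a::alg_closed_field poly"
  assumes "CHAR('a) > 0" "pderiv u = 0"
  obtains v where "u = v ^ CHAR('a)"
proof -
  define p where "p = CHAR('a)"
  have p: "prime p" using assms(1) prime_CHAR_semidom unfolding p_def by blast
  have coeff0: "Polynomial.coeff u n = 0" if "\<not> p dvd n" for n
  proof (cases n)
    case (Suc m)
    have "of_nat (Suc m) * Polynomial.coeff u (Suc m) = 0"
      using assms(2) by (metis coeff_pderiv coeff_0)
    moreover have "of_nat (Suc m) \<noteq> (0::'a)"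
      using that Suc p_def of_nat_eq_0_iff_char_dvd by blast
    ultimately show ?thesis using Suc by simp
  qed (use that in auto)
  have "\<exists>y. y ^ p = Polynomial.coeff u (p * i)" for i
    by (rule nth_root_exists[OF prime_gt_0_nat[OF p]])
  then have "\<forall>i. \<exists>y. y ^ p = Polynomial.coeff u (p * i)" by (rule allI)
  from choice[OF this] obtain r where r: "\<forall>i. r i ^ p = Polynomial.coeff u (p * i)" ..
  define v where "v = (\<Sum>i\<le>Polynomial.degree u. Polynomial.monom (r i) i)"
  have "v ^ p = (\<Sum>i\<le>Polynomial.degree u. Polynomial.monom (Polynomial.coeff u (p * i)) (p * i))"
  proof -
    have "v ^ p = (\<Sum>i\<le>Polynomial.degree u. Polynomial.monom (r i) i ^ p)"
      unfolding v_def by (rule freshmans_dream_sum) (use p in \<open>simp_all add: p_def\<close>)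
    then show ?thesis using r by (simp add: monom_power mult.commute[of _ p])
  qed
  also have "\<dots> = u"
  proof (rule poly_eqI)
    fix n
    have "(\<Sum>i\<le>Polynomial.degree u. Polynomial.coeff (Polynomial.monom (Polynomial.coeff u (p * i)) (p * i)) n)
        = (\<Sum>i\<le>Polynomial.degree u. if n = p * i then Polynomial.coeff u n else 0)"
      by (intro sum.cong) auto
    also have "\<dots> = Polynomial.coeff u n"
    proof (cases "p dvd n \<and> n \<le> Polynomial.degree u")
      case True
      then obtain m where m: "n = p * m" by blast
      have "m \<le> n" using prime_gt_0_nat[OF p] m by simp
      then have "m \<le> Polynomial.degree u" using True by simp
      moreover have "n = p * i \<longleftrightarrow> i = m" for i using m prime_gt_0_nat[OF p] by auto
      ultimately show ?thesis by simp
    next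
      case False
      then have "Polynomial.coeff u n = 0" using coeff0 coeff_eq_0 by (metis not_le)
      then show ?thesis by (simp only: if_cancel sum.neutral_const)
    qed
    finally show "Polynomial.coeff (\<Sum>i\<le>Polynomial.degree u. Polynomial.monom (Polynomial.coeff u (p * i)) (p * i)) n
        = Polynomial.coeff u n"
      by (simp add: coeff_sum)
  qed
  finally have "v ^ CHAR('a) = u" by (simp add: p_def)
  from that[OF this[symmetric]] show ?thesis .
qed

lemma dvd_pderiv_imp_pderiv_eq_0:
  fixes u :: "'a::field poly"
  assumes "u dvd pderiv u"
  shows "pderiv u = 0"
proof (rule ccontr)
  assume nz: "pderiv u \<noteq> 0"
  then have "Polynomial.degree u \<noteq> 0" by (metis degree_eq_zeroE pderiv_singleton)
  have "Polynomial.degree (pderiv u) \<le> Polynomial.degree u - 1"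
    by (rule degree_le) (auto simp: coeff_pderiv coeff_eq_0)
  then show False
    using dvd_imp_degree_le[OF assms nz] \<open>Polynomial.degree u \<noteq> 0\<close> by linarith
qed

text \<open>
  The hypothesis says that the quotient of \<open>f\<close> and \<open>g\<close> has derivative zero. In lowest terms
  \<open>u / v\<close> this becomes \<open>v u' = u v'\<close>; since \<open>u\<close> and \<open>v\<close> are coprime, each divides its own
  derivative, which has smaller degree.
\<close>

lemma equal_log_deriv_imp_common_factor:
  fixes f g :: "'a::{field, factorial_ring_gcd, semiring_gcd_mult_normalize} poly"
  assumes "f \<noteq> 0" "g * pderiv f = f * pderiv g"
  obtains w u v where "f = w * u" "g = w * v" "pderiv u = 0" "pderiv v = 0"
proof -
  define w where "w = gcd f g"
  have "w \<noteq> 0" using assms by (simp add: w_def)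
  then obtain u v where uv: "f = u * w" "g = v * w" "coprime u v"
    using gcd_coprime_exists[of f g] unfolding w_def by blast
  have "(v * w) * pderiv (u * w) - (u * w) * pderiv (v * w) = (w * w) * (v * pderiv u - u * pderiv v)"
    unfolding pderiv_mult by (simp add: algebra_simps)
  moreover have "(v * w) * pderiv (u * w) - (u * w) * pderiv (v * w) = 0"
    using assms(2) by (simp only: uv(1,2) diff_self)
  ultimately have "v * pderiv u = u * pderiv v"
    using \<open>w \<noteq> 0\<close> by simp
  then have "u dvd v * pderiv u" "v dvd u * pderiv v"
    by (metis dvd_triv_left)+
  then have "u dvd pderiv u" "v dvd pderiv v"
    using uv(3) by (metis coprime_dvd_mult_right_iff coprime_commute)+
  then show ?thesis
    using that[of w u v] uv by (simp add: dvd_pderiv_imp_pderiv_eq_0 mult.commute)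
qed

lemma order_power:
  fixes f :: "'a::idom poly"
  assumes "f \<noteq> 0"
  shows "Polynomial.order \<alpha> (f ^ n) = n * Polynomial.order \<alpha> f"
  using assms by (induction n) (simp_all add: order_mult)

lemma finite_high_order:
  fixes f :: "'a::idom poly"
  assumes "f \<noteq> 0" "q > 0"
  shows "finite {\<alpha>. \<alpha> \<noteq> 0 \<and> q \<le> Polynomial.order \<alpha> f}"
  by (rule finite_subset[OF _ poly_roots_finite[OF assms(1)]]) (use assms in \<open>auto simp: order_root\<close>)

text \<open>
  Here \<open>f = g + h\<close> has a gap: no monomials strictly between the top exponent of \<open>g\<close> and the bottom
  exponent of \<open>h\<close>. Let \<open>R\<close> be the product of \<open>x - \<alpha>\<close> over the \<open>r\<close> distinct nonzero roots of \<open>f\<close>.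
  Then \<open>x R f' = f H\<close> with \<open>deg H \<le> r\<close>. The same expression formed with \<open>g\<close>, that is
  \<open>x R g' - g H\<close>, is the negative of the one formed with \<open>h\<close>. Thus it has degree at most
  \<open>r + deg g\<close>, and it is divisible by the power of \<open>x\<close> that divides \<open>h\<close>. If the gap is longer than
  \<open>r\<close>, it must vanish, so \<open>f\<close> and \<open>g\<close> have the same logarithmic derivative. In characteristic \<open>0\<close>
  they are then proportional, against their degrees. In characteristic \<open>p\<close> they are \<open>w U\<^sup>p\<close> and
  \<open>w V\<^sup>p\<close>, whence \<open>h = w (U - V)\<^sup>p\<close>. Now \<open>U = V + (U - V)\<close> has smaller degree and a gap at
  least \<open>1/p\<close> times as long, and \<open>p\<close> times the multiplicity of a root of \<open>U\<close> is a lower bound for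
  its multiplicity in \<open>f\<close>. This last step is what brings in the powers of \<open>p\<close>.
\<close>

lemma gap_le_multiplicity_count:
  fixes g h :: "'a::{alg_closed_field, euclidean_ring_gcd, semiring_gcd_mult_normalize} poly"
  assumes "g \<noteq> 0" "h \<noteq> 0" "Polynomial.degree g < Polynomial.order 0 h"
  shows "\<exists>q\<in>char_powers (field_characteristic TYPE('a)).
     Polynomial.order 0 h - Polynomial.degree g
       \<le> q * card {\<alpha>. \<alpha> \<noteq> 0 \<and> q \<le> Polynomial.order \<alpha> (g + h)}"
  using assms
proof (induction "Polynomial.degree (g + h)" arbitrary: g h rule: less_induct)
  case (less g h)
  define f where "f = g + h"
  define S where "S = {\<alpha>. \<alpha> \<noteq> 0 \<and> 1 \<le> Polynomial.order \<alpha> f}"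
  have deg_h: "Polynomial.order 0 h \<le> Polynomial.degree h"
    using less.prems by (intro order_degree)
  then have deg_f: "Polynomial.degree f = Polynomial.degree h"
    unfolding f_def using less.prems by (intro degree_add_eq_right) linarith
  have "f \<noteq> 0" using deg_f deg_h less.prems by auto
  have finS: "finite S" unfolding S_def using \<open>f \<noteq> 0\<close> by (intro finite_high_order) auto
  show ?case
  proof (cases "Polynomial.order 0 h - Polynomial.degree g \<le> card S")
    case True
    have "1 \<in> char_powers (field_characteristic TYPE('a))"
      by (auto simp: char_powers_def field_characteristic_def intro: range_eqI[of _ _ 0])
    then show ?thesis
      using True unfolding S_def f_def by (intro bexI[of _ 1]) simp_all
  next
    case False
    define R where "R = (\<Prod>\<alpha>\<in>S. [:-\<alpha>, 1:])"
    have degR: "Polynomial.degree R = card S"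
      unfolding R_def by (subst degree_prod_eq_sum_degree) auto
    \<comment> \<open>The factor \<open>x\<close> takes care of a root at \<open>0\<close>, and it makes up for the power of \<open>x\<close> that \<open>h\<close> loses
      when differentiated.\<close>
    define xR where "xR = (\<Prod>\<alpha>\<in>insert 0 S. [:-\<alpha>, 1:])"
    have xR: "xR = [:0, 1:] * R"
      unfolding xR_def R_def by (subst prod.insert) (use finS in \<open>auto simp: S_def\<close>)
    have deg_xR: "Polynomial.degree xR \<le> card S + 1"
      unfolding xR using degR by (simp add: degree_pCons_eq_if)
    have "f dvd xR * pderiv f"
      unfolding xR_def using \<open>f \<noteq> 0\<close> finS
      by (intro dvd_prod_roots_mult_pderiv) (auto simp: S_def order_root)
    then obtain H where H: "xR * pderiv f = f * H" by (rule dvdE)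
    have deg_pd: "Polynomial.degree (pderiv k) \<le> Polynomial.degree k - 1" for k :: "'a poly"
      by (rule degree_le) (auto simp: coeff_pderiv coeff_eq_0)
    have degH: "Polynomial.degree H \<le> card S"
    proof (cases "H = 0")
      case False
      have "Polynomial.degree f + Polynomial.degree H = Polynomial.degree (xR * pderiv f)"
        unfolding H using False \<open>f \<noteq> 0\<close> by (simp add: degree_mult_eq)
      also have "\<dots> \<le> Polynomial.degree xR + Polynomial.degree (pderiv f)"
        by (rule degree_mult_le)
      also have "\<dots> \<le> card S + 1 + (Polynomial.degree f - 1)"
        using deg_xR deg_pd[of f] by linarith
      finally show ?thesis using deg_f deg_h less.prems by linarith
    qed simp
    define E where "E = xR * pderiv g - g * H"
    have E': "E = h * H - xR * pderiv h"
      using H unfolding E_def f_def pderiv_add by (simp add: algebra_simps)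
    have "E = 0"
    proof (rule ccontr)
      assume "E \<noteq> 0"
      let ?X = "Polynomial.monom (1::'a) (Polynomial.order 0 h)"
      have Xh: "?X dvd h"
        using monom_1_dvd_iff[OF \<open>h \<noteq> 0\<close>] by blast
      then have "Polynomial.coeff (pCons 0 (pderiv h)) k = 0" if "k < Polynomial.order 0 h" for k
        using that by (cases k) (simp_all add: monom_1_dvd_iff' coeff_pderiv)
      then have "?X dvd [:0, 1:] * pderiv h"
        by (simp add: monom_1_dvd_iff')
      then have "?X dvd xR * pderiv h"
        unfolding xR by (simp only: mult.assoc mult.left_commute[of "[:0, 1:]" R] dvd_mult)
      then have "?X dvd E"
        unfolding E' using Xh by (intro dvd_diff dvd_mult2[OF Xh])
      then have "Polynomial.order 0 h \<le> Polynomial.degree E"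
        using \<open>E \<noteq> 0\<close> by (metis dvd_imp_degree_le degree_monom_eq one_neq_zero)
      moreover have "Polynomial.degree (xR * pderiv g) \<le> card S + Polynomial.degree g"
      proof (cases "Polynomial.degree g = 0")
        case True
        then have "pderiv g = 0" by (metis degree_eq_zeroE pderiv_singleton)
        then show ?thesis by simp
      next
        case False
        then show ?thesis
          using degree_mult_le[of xR "pderiv g"] deg_xR deg_pd[of g] by linarith
      qed
      moreover have "Polynomial.degree (g * H) \<le> card S + Polynomial.degree g"
        using degree_mult_le[of g H] degH by linarith
      ultimately have "Polynomial.order 0 h \<le> card S + Polynomial.degree g"
        unfolding E_def using degree_diff_le le_trans by blast
      then show False using False by linarith
    qed
    have "xR \<noteq> 0" unfolding xR R_def using finS by auto
    moreover have "xR * (g * pderiv f) = xR * (f * pderiv g)"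
      using H \<open>E = 0\<close> unfolding E_def by (simp add: algebra_simps)
    ultimately have "g * pderiv f = f * pderiv g" by simp
    with \<open>f \<noteq> 0\<close> obtain w u v where wuv: "f = w * u" "g = w * v" "pderiv u = 0" "pderiv v = 0"
      by (rule equal_log_deriv_imp_common_factor)
    have nz: "w \<noteq> 0" "u \<noteq> 0" "v \<noteq> 0" using wuv \<open>f \<noteq> 0\<close> \<open>g \<noteq> 0\<close> by auto
    define p where "p = CHAR('a)"
    have "p > 0"
    proof (rule ccontr)
      assume "\<not> p > 0"
      then have "of_nat (Suc n) \<noteq> (0::'a)" for n
        using of_nat_eq_0_iff_char_dvd[where 'a = 'a, of "Suc n"] by (simp add: p_def del: of_nat_Suc)
      then have "Polynomial.degree k = 0" if "pderiv k = 0" for k :: "'a poly"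
      proof (cases "Polynomial.degree k")
        case (Suc n)
        have "of_nat (Suc n) * Polynomial.coeff k (Suc n) = 0"
          using that by (metis coeff_pderiv coeff_0)
        then have "Polynomial.coeff k (Polynomial.degree k) = 0"
          using \<open>of_nat (Suc n) \<noteq> 0\<close> Suc by simp
        then show ?thesis by (simp only: leading_coeff_0_iff degree_0)
      qed
      then have "Polynomial.degree f = Polynomial.degree g"
        using wuv nz by (simp add: degree_mult_eq)
      then show False using deg_f deg_h less.prems by linarith
    qed
    then have prime: "prime p" using prime_CHAR_semidom unfolding p_def by blast
    obtain U where U: "u = U ^ p"
      using pderiv_eq_0_imp_CHAR_power wuv(3) \<open>p > 0\<close> unfolding p_def by blast
    obtain V where V: "v = V ^ p"
      using pderiv_eq_0_imp_CHAR_power wuv(4) \<open>p > 0\<close> unfolding p_def by blast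
    define W where "W = U - V"
    have "U ^ p = V ^ p + W ^ p"
      using freshmans_dream[of p V W] prime by (simp add: W_def p_def)
    then have h: "h = w * W ^ p"
      using wuv(1,2) unfolding f_def U V by (simp add: algebra_simps)
    have nz': "U \<noteq> 0" "V \<noteq> 0" "W \<noteq> 0"
      using nz U V h \<open>h \<noteq> 0\<close> \<open>p > 0\<close> by auto
    have ord_h: "Polynomial.order 0 h = Polynomial.order 0 w + p * Polynomial.order 0 W"
      unfolding h using nz nz' by (simp add: order_mult order_power)
    have deg_g: "Polynomial.degree g = Polynomial.degree w + p * Polynomial.degree V"
      unfolding wuv(2) V using nz nz' by (simp add: degree_mult_eq degree_power_eq)
    \<comment> \<open>The gap of \<open>U\<close> is long enough because \<open>w\<close> contributes at most its degree to the order at \<open>0\<close>.\<close>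
    have gap: "Polynomial.order 0 h - Polynomial.degree g
        \<le> p * (Polynomial.order 0 W - Polynomial.degree V)"
      unfolding ord_h deg_g diff_mult_distrib2 using order_degree[OF nz(1), of 0] by linarith
    then have lt: "Polynomial.degree V < Polynomial.order 0 W"
      using less.prems(3) by (cases "Polynomial.degree V < Polynomial.order 0 W") simp_all
    moreover have "Polynomial.order 0 W \<le> Polynomial.degree W"
      using nz' by (intro order_degree)
    ultimately have "Polynomial.degree U > 0"
      using degree_diff_le_max[of U V] by (auto simp: W_def)
    then have "Polynomial.degree U < Polynomial.degree f"
      unfolding wuv(1) U using nz nz' prime_gt_1_nat[OF prime]
      by (simp add: degree_mult_eq degree_power_eq trans_less_add2)
    then obtain q where q: "q \<in> char_powers (field_characteristic TYPE('a))"
      "Polynomial.order 0 W - Polynomial.degree V \<le> q * card {\<alpha>. \<alpha> \<noteq> 0 \<and> q \<le> Polynomial.order \<alpha> U}"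
      using less.hyps[of V W] nz' lt by (auto simp: W_def f_def)
    have pq: "p * q \<in> char_powers (field_characteristic TYPE('a))"
      using q(1) \<open>p > 0\<close>
      by (auto simp: char_powers_def field_characteristic_def p_def simp flip: power_Suc)
    have "card {\<alpha>. \<alpha> \<noteq> 0 \<and> q \<le> Polynomial.order \<alpha> U}
        \<le> card {\<alpha>. \<alpha> \<noteq> 0 \<and> p * q \<le> Polynomial.order \<alpha> f}"
    proof (intro card_mono finite_high_order)
      show "p * q > 0" using \<open>p > 0\<close> char_powers_pos[OF q(1)] by simp
      show "{\<alpha>. \<alpha> \<noteq> 0 \<and> q \<le> Polynomial.order \<alpha> U} \<subseteq> {\<alpha>. \<alpha> \<noteq> 0 \<and> p * q \<le> Polynomial.order \<alpha> f}"
        unfolding wuv(1) U using nz nz' by (auto simp: order_mult order_power intro: trans_le_add2)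
    qed fact
    then have "p * (Polynomial.order 0 W - Polynomial.degree V)
        \<le> p * q * card {\<alpha>. \<alpha> \<noteq> 0 \<and> p * q \<le> Polynomial.order \<alpha> f}"
      using mult_le_mono2[OF le_trans[OF q(2) mult_le_mono2], of _ p] by (simp only: mult.assoc)
    with gap have "Polynomial.order 0 h - Polynomial.degree g
        \<le> p * q * card {\<alpha>. \<alpha> \<noteq> 0 \<and> p * q \<le> Polynomial.order \<alpha> f}"
      by (rule le_trans)
    with pq show ?thesis unfolding f_def by (rule bexI[rotated])
  qed
qed

text \<open>
  The same bound for a window of zero coefficients with nonzero coefficients on both sides: the
  polynomial is cut at \<open>l\<close>.
\<close>

lemma vanishing_coeffs_le_multiplicity_count:
  fixes f :: "'a::{alg_closed_field, euclidean_ring_gcd, semiring_gcd_mult_normalize} poly"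
  assumes "k < l" and gap: "\<And>i. k < i \<Longrightarrow> i < l \<Longrightarrow> Polynomial.coeff f i = 0"
    and "i \<le> k" "Polynomial.coeff f i \<noteq> 0" "l \<le> j" "Polynomial.coeff f j \<noteq> 0"
  shows "\<exists>q\<in>char_powers (field_characteristic TYPE('a)).
     l - k \<le> q * card {\<alpha>. \<alpha> \<noteq> 0 \<and> q \<le> Polynomial.order \<alpha> f}"
proof -
  define g where "g = poly_cutoff l f"
  define h where "h = f - g"
  have "Polynomial.coeff g i \<noteq> 0" "Polynomial.coeff h j \<noteq> 0"
    using assms by (simp_all add: g_def h_def coeff_poly_cutoff)
  then have nz: "g \<noteq> 0" "h \<noteq> 0" by auto
  have deg: "Polynomial.degree g \<le> k"
    using gap by (intro degree_le) (auto simp: g_def coeff_poly_cutoff)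
  have "Polynomial.monom 1 l dvd h"
    by (simp add: monom_1_dvd_iff' h_def g_def coeff_poly_cutoff)
  then have ord: "l \<le> Polynomial.order 0 h"
    using nz monom_1_dvd_iff by blast
  obtain q where q: "q \<in> char_powers (field_characteristic TYPE('a))"
      "Polynomial.order 0 h - Polynomial.degree g \<le> q * card {\<alpha>. \<alpha> \<noteq> 0 \<and> q \<le> Polynomial.order \<alpha> (g + h)}"
    using gap_le_multiplicity_count[OF nz] deg ord \<open>k < l\<close> by auto
  have "l - k \<le> Polynomial.order 0 h - Polynomial.degree g"
    using deg ord by linarith
  also note q(2)
  also have "g + h = f" by (simp add: h_def)
  finally show ?thesis using q(1) by (rule bexI)
qed

section \<open>Combinatorial Nullstellensatz in two variables\<close>

text \<open>
  These weights are the divided-difference coefficients: \<open>w a\<close> is the inverse of the product of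
  \<open>a - b\<close> over the other points \<open>b\<close>. The induction splits off a point \<open>a\<close> and applies the functional
  on the remaining points to \<open>(f - f(a)) / (x - a)\<close>, which has the same leading coefficient.
\<close>

lemma leading_coeff_functional:
  fixes A :: "'a::field set"
  assumes "finite A" "card A = Suc s"
  obtains w where "\<And>f. Polynomial.degree f \<le> s \<Longrightarrow> (\<Sum>a\<in>A. w a * poly f a) = Polynomial.coeff f s"
proof -
  have "\<exists>w. \<forall>f. Polynomial.degree f \<le> s \<longrightarrow> (\<Sum>a\<in>A. w a * poly f a) = Polynomial.coeff f s"
    using assms
  proof (induction s arbitrary: A)
    case 0
    then obtain a where "A = {a}" using card_1_singletonE by force
    then show ?case by (intro exI[of _ "\<lambda>_. 1"]) (auto elim!: degree_eq_zeroE)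
  next
    case (Suc s)
    then obtain a B where B: "A = insert a B" "a \<notin> B" "card B = Suc s" "finite B"
      by (metis card_Suc_eq finite_insert)
    with Suc.IH obtain w where w:
      "\<And>f. Polynomial.degree f \<le> s \<Longrightarrow> (\<Sum>b\<in>B. w b * poly f b) = Polynomial.coeff f s"
      by blast
    define w' where "w' x = (if x = a then - (\<Sum>b\<in>B. w b / (b - a)) else w x / (x - a))" for x
    have "(\<Sum>x\<in>A. w' x * poly f x) = Polynomial.coeff f (Suc s)"
      if "Polynomial.degree f \<le> Suc s" for f
    proof -
      define g where "g = synthetic_div f a"
      have deg_g: "Polynomial.degree g \<le> s"
        using that by (simp add: g_def degree_synthetic_div)
      have f: "f = [:-a, 1:] * g + [:poly f a:]"
        unfolding g_def by (rule synthetic_div_correct'[symmetric])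
      have "Polynomial.coeff f (Suc s) = Polynomial.coeff g s"
        using deg_g by (subst f) (simp add: coeff_eq_0)
      also have "\<dots> = (\<Sum>b\<in>B. w b * poly g b)" using w deg_g by simp
      also have "\<dots> = (\<Sum>b\<in>B. w b / (b - a) * (poly f b - poly f a))"
      proof (intro sum.cong refl)
        fix b assume "b \<in> B"
        then have "b - a \<noteq> 0" using B by auto
        moreover have "poly f b = (b - a) * poly g b + poly f a"
          by (subst f) (simp add: algebra_simps)
        ultimately show "w b * poly g b = w b / (b - a) * (poly f b - poly f a)" by simp
      qed
      also have "\<dots> = (\<Sum>b\<in>B. w b / (b - a) * poly f b) + w' a * poly f a"
        by (simp add: w'_def right_diff_distrib sum_subtractf sum_distrib_right)
      also have "(\<Sum>b\<in>B. w b / (b - a) * poly f b) = (\<Sum>b\<in>B. w' b * poly f b)"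
        using B by (intro sum.cong) (auto simp: w'_def)
      finally show ?thesis using B by (simp add: add.commute)
    qed
    then show ?case by blast
  qed
  then show ?thesis using that by blast
qed

text \<open>
  Combinatorial Nullstellensatz for two variables. The functional above, taken in \<open>y\<close> over \<open>t + 1\<close>
  points of \<open>B\<close>, kills the powers of \<open>y\<close> below \<open>t\<close>. So it turns \<open>Q\<close> into a polynomial in \<open>x\<close> in
  which all contributions from powers above \<open>t\<close> have degree below \<open>s\<close>: its degree is at most \<open>s\<close>,
  and its coefficient at \<open>s\<close> is the one in question. It vanishes on \<open>A\<close>, hence identically.
\<close>

lemma nullstellensatz2:
  fixes Q :: "'a::field poly poly"
  assumes "finite A" "s < card A" "finite B" "t < card B"
    and deg: "\<And>i j. s + t < i + j \<Longrightarrow> Polynomial.coeff (Polynomial.coeff Q j) i = 0"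
    and zero: "\<And>a b. a \<in> A \<Longrightarrow> b \<in> B \<Longrightarrow> poly2 Q a b = 0"
  shows "Polynomial.coeff (Polynomial.coeff Q t) s = 0"
proof -
  obtain B' where B': "B' \<subseteq> B" "card B' = Suc t" "finite B'"
    using obtain_subset_with_card_n[of "Suc t" B] assms(4) by auto
  then obtain w where w:
    "\<And>f. Polynomial.degree f \<le> t \<Longrightarrow> (\<Sum>b\<in>B'. w b * poly f b) = Polynomial.coeff f t"
    using leading_coeff_functional by metis
  define M where "M j = (\<Sum>b\<in>B'. w b * b ^ j)" for j
  have M: "M j = (if j = t then 1 else 0)" if "j \<le> t" for j
    using w[of "Polynomial.monom 1 j"] that by (simp add: M_def poly_monom degree_monom_eq)
  define T where "T = (\<Sum>b\<in>B'. Polynomial.smult (w b) (poly Q [:b:]))"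
  have coeff_T: "Polynomial.coeff T i = Polynomial.coeff (Polynomial.coeff Q t) i" if "s \<le> i" for i
  proof -
    let ?q = "\<lambda>j. Polynomial.coeff (Polynomial.coeff Q j) i"
    have "Polynomial.coeff T i = (\<Sum>b\<in>B'. \<Sum>j\<le>Polynomial.degree Q. w b * b ^ j * ?q j)"
      unfolding T_def
      by (simp add: coeff_sum poly_altdef sum_distrib_left poly_const_pow mult_ac)
    also have "\<dots> = (\<Sum>j\<le>Polynomial.degree Q. M j * ?q j)"
      unfolding M_def sum_distrib_right by (rule sum.swap)
    also have "\<dots> = (\<Sum>j\<le>Polynomial.degree Q. if j = t then ?q t else 0)"
    proof (intro sum.cong refl)
      fix j
      show "M j * ?q j = (if j = t then ?q t else 0)"
        using M[of j] deg[of i j] that by (cases j t rule: linorder_cases) auto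
    qed
    also have "\<dots> = ?q t"
      by (auto simp: coeff_eq_0)
    finally show ?thesis .
  qed
  have "T = 0"
  proof (rule ccontr)
    assume "T \<noteq> 0"
    have "Polynomial.degree T \<le> s"
      using deg coeff_T by (intro degree_le) auto
    moreover have "A \<subseteq> {a. poly T a = 0}"
      using zero B' by (auto simp: T_def poly_sum poly2_def intro!: sum.neutral)
    ultimately show False
      using card_mono[OF poly_roots_finite[OF \<open>T \<noteq> 0\<close>] \<open>A \<subseteq> _\<close>] card_poly_roots_bound[OF \<open>T \<noteq> 0\<close>]
        assms(2) by linarith
  qed
  then show ?thesis using coeff_T[of s] by simp
qed

section \<open>Leading forms\<close>

text \<open>
  The polynomial \<open>g\<close> is the homogeneous part of degree \<open>D\<close> of \<open>Q\<close>, evaluated at \<open>y = 1\<close>. Since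
  \<open>i + j = D\<close>, no coefficient is lost by this. The part may be zero.
\<close>

definition has_leading_form :: "nat \<Rightarrow> 'a::comm_ring_1 poly poly \<Rightarrow> 'a poly \<Rightarrow> bool" where
  "has_leading_form D Q g \<longleftrightarrow> Polynomial.degree g \<le> D \<and>
     (\<forall>i j. i + j = D \<longrightarrow> Polynomial.coeff (Polynomial.coeff Q j) i = Polynomial.coeff g i) \<and>
     (\<forall>i j. D < i + j \<longrightarrow> Polynomial.coeff (Polynomial.coeff Q j) i = 0)"

lemma has_leading_form_mult_linear:
  assumes "has_leading_form D Q g"
  shows "has_leading_form (Suc D) ([:[:-c, 1:], 1:] * Q) ([:1, 1:] * g)"
proof -
  have g: "Polynomial.coeff g i = 0" if "D < i" for i
    using assms that by (simp add: has_leading_form_def coeff_eq_0)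
  have "Polynomial.degree ([:1, 1:] * g) \<le> Suc D"
    by (rule degree_le) (auto simp: coeff_pCons g split: nat.split)
  moreover have "Polynomial.coeff (Polynomial.coeff ([:[:-c, 1:], 1:] * Q) j) i = Polynomial.coeff ([:1, 1:] * g) i"
    if "i + j = Suc D" for i j
    using assms that g by (cases i; cases j) (auto simp: has_leading_form_def)
  moreover have "Polynomial.coeff (Polynomial.coeff ([:[:-c, 1:], 1:] * Q) j) i = 0"
    if "Suc D < i + j" for i j
    using assms that by (cases i; cases j) (auto simp: has_leading_form_def)
  ultimately show ?thesis unfolding has_leading_form_def by blast
qed

lemma has_leading_form_mult_prod:
  assumes "has_leading_form D Q g" "finite C"
  shows "has_leading_form (D + card C) ((\<Prod>c\<in>C. [:[:-c, 1:], 1:]) * Q) ([:1, 1:] ^ card C * g)"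
  using assms(2,1)
proof (induction C rule: finite_induct)
  case (insert c C)
  then show ?case
    using has_leading_form_mult_linear[of "D + card C" "(\<Prod>c\<in>C. [:[:-c, 1:], 1:]) * Q" "[:1, 1:] ^ card C * g" c]
    by (simp only: prod.insert card_insert_disjoint power_Suc mult.assoc add_Suc_right simp_thms)
qed simp

text \<open>
  The product of \<open>P\<close> with all \<open>x + y - c\<close>, for \<open>c\<close> in \<open>C\<close>, vanishes on \<open>A \<times> B\<close>. Each of these
  factors has leading form \<open>x + y\<close>, which contributes a factor \<open>1 + x\<close>.
\<close>

lemma restricted_sumset_imp_coeff_eq_0:
  fixes P :: "'a::field poly poly"
  assumes "finite A" "finite B" "finite C" "has_leading_form d P g"
    and C: "\<And>a b. a \<in> A \<Longrightarrow> b \<in> B \<Longrightarrow> poly2 P a b \<noteq> 0 \<Longrightarrow> a + b \<in> C"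
    and "s < card A" "t < card B" "s + t = d + card C"
  shows "Polynomial.coeff ([:1, 1:] ^ card C * g) s = 0"
proof -
  let ?Q = "(\<Prod>c\<in>C. [:[:-c, 1:], 1:]) * P"
  have lf: "has_leading_form (d + card C) ?Q ([:1, 1:] ^ card C * g)"
    using assms by (intro has_leading_form_mult_prod)
  have "poly2 ?Q a b = (\<Prod>c\<in>C. a + b - c) * poly2 P a b" for a b
    by (simp add: poly2_def poly_prod algebra_simps)
  then have "poly2 ?Q a b = 0" if "a \<in> A" "b \<in> B" for a b
    using C[OF that] \<open>finite C\<close> by auto
  then have "Polynomial.coeff (Polynomial.coeff ?Q t) s = 0"
    using assms lf by (intro nullstellensatz2[of A s B t]) (auto simp: has_leading_form_def)
  then show ?thesis
    using lf assms(8) by (simp add: has_leading_form_def)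
qed

lemma has_leading_formI:
  fixes P P\<^sub>0 R :: "'a::comm_ring_1 poly poly"
  assumes "homogeneous2 d P\<^sub>0" "P = P\<^sub>0 + R" "total_degree R < int d"
  shows "has_leading_form d P (poly P\<^sub>0 1)"
proof -
  have P0: "Polynomial.coeff (Polynomial.coeff P\<^sub>0 j) i = 0" if "i + j \<noteq> d" for i j
  proof -
    have "int i + int j \<noteq> int d" using that by linarith
    then have "coeff2 P\<^sub>0 (int i) (int j) = 0"
      using assms(1) unfolding homogeneous2_def by blast
    then show ?thesis by (simp add: coeff2_def)
  qed
  have R: "Polynomial.coeff (Polynomial.coeff R j) i = 0" if "d \<le> i + j" for i j
  proof (rule ccontr)
    assume nz: "Polynomial.coeff (Polynomial.coeff R j) i \<noteq> 0"
    then have "R \<noteq> 0" by auto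
    have "coeff2 R (int i) (int j) \<noteq> 0" using nz by (simp add: coeff2_def)
    then have "int i + int j \<le> Max {i + j | i j. coeff2 R i j \<noteq> 0}"
      by (intro Max_ge finite_total_degree_set) blast
    then show False using assms(3) that \<open>R \<noteq> 0\<close> by (simp add: total_degree_def)
  qed
  have coeff: "Polynomial.coeff (poly P\<^sub>0 1) i = Polynomial.coeff (Polynomial.coeff P\<^sub>0 j) i"
    if "i + j = d" for i j
  proof -
    have "Polynomial.coeff (poly P\<^sub>0 1) i
        = (\<Sum>j'\<le>Polynomial.degree P\<^sub>0. Polynomial.coeff (Polynomial.coeff P\<^sub>0 j') i)"
      by (simp add: poly_altdef coeff_sum)
    also have "\<dots> = (\<Sum>j'\<le>Polynomial.degree P\<^sub>0. if j' = j then Polynomial.coeff (Polynomial.coeff P\<^sub>0 j) i else 0)"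
      using P0 that by (intro sum.cong) auto
    also have "\<dots> = Polynomial.coeff (Polynomial.coeff P\<^sub>0 j) i"
      by (auto simp: coeff_eq_0)
    finally show ?thesis .
  qed
  have "Polynomial.degree (poly P\<^sub>0 1) \<le> d"
    by (rule degree_le) (simp add: poly_altdef coeff_sum P0)
  then show ?thesis
    unfolding has_leading_form_def assms(2) using P0 R coeff by simp
qed

section \<open>The size of a restricted sumset\<close>

lemma map_poly_to_ac_mult:
  "map_poly to_ac (f * g) = map_poly to_ac f * map_poly to_ac g"
  by (rule poly_eqI) (simp add: coeff_map_poly coeff_mult to_ac_sum)

lemma closure_mult_mult_power:
  fixes g :: "'a::field poly"
  assumes "g \<noteq> 0"
  shows "closure_mult ([:1, 1:] ^ n * g) \<alpha> = closure_mult g \<alpha> + (if \<alpha> = -1 then n else 0)"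
proof -
  have pow: "map_poly to_ac ([:1, 1:] ^ n :: 'a poly) = [:1, 1:] ^ n"
    by (induction n) (simp_all add: map_poly_to_ac_mult map_poly_pCons del: mult_pCons_left)
  have "map_poly to_ac g \<noteq> 0"
    using assms by (simp add: map_poly_eq_0_iff)
  then have "Polynomial.order \<alpha> (map_poly to_ac ([:1, 1:] ^ n * g))
      = Polynomial.order \<alpha> ([:1, 1:] ^ n) + Polynomial.order \<alpha> (map_poly to_ac g)"
    unfolding map_poly_to_ac_mult pow by (intro order_mult) auto
  moreover have "Polynomial.order \<alpha> ([:1, 1:] ^ n) = (if \<alpha> = -1 then n else 0)"
  proof (cases "\<alpha> = -1")
    case True
    then show ?thesis using order_power_n_n[of "-1 :: 'a alg_closure" n] by simp
  next
    case False
    then have "1 + \<alpha> \<noteq> 0" by (metis add.commute eq_neg_iff_add_eq_0)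
    then show ?thesis using False by (simp add: order_0I)
  qed
  ultimately show ?thesis by (simp add: closure_mult_def)
qed

lemma lowest_coeff_mult_power:
  fixes g :: "'a::comm_ring_1 poly"
  assumes "\<And>k. k < m \<Longrightarrow> Polynomial.coeff g k = 0"
  shows "Polynomial.coeff ([:1, 1:] ^ n * g) m = Polynomial.coeff g m"
proof -
  have "(\<forall>k<m. Polynomial.coeff ([:1, 1:] ^ n * g) k = 0) \<and>
      Polynomial.coeff ([:1, 1:] ^ n * g) m = Polynomial.coeff g m"
  proof (induction n)
    case (Suc n)
    have "Polynomial.coeff ([:1, 1:] ^ Suc n * g) k
        = Polynomial.coeff ([:1, 1:] ^ n * g) k
          + (if k = 0 then 0 else Polynomial.coeff ([:1, 1:] ^ n * g) (k - 1))" for k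
      unfolding power_Suc mult.assoc by (cases k) simp_all
    then show ?case using Suc by auto
  qed (use assms in simp)
  then show ?thesis by blast
qed

text \<open>
  Let \<open>n = |C|\<close>, and suppose that \<open>d + n < |A| + |B|\<close>. The coefficients of \<open>F = (1 + x)\<^sup>n g\<close> vanish strictly between \<open>d + n - |B|\<close> and
  \<open>|A|\<close>. The coefficient of \<open>g\<close> at \<open>i\<close> puts the lowest term of \<open>F\<close> below this window, the one at
  \<open>d - j\<close> puts its leading term above. So \<open>|A| + |B| - d - n\<close> is at most \<open>q\<close> times the number of
  nonzero roots of \<open>F\<close> of multiplicity at least \<open>q\<close>. Such a count differs from the one defining
  \<open>N_max g\<close> at \<open>-1\<close> only. For \<open>q = 1\<close> this costs \<open>1\<close>; for \<open>q \<ge> p\<close> the multiplicity of \<open>-1\<close> in \<open>F\<close>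
  is too small to count.
\<close>

lemma card_restricted_sumset_ge:
  fixes P :: "'a::field poly poly"
  assumes fin: "finite A" "finite B" "finite C" and lf: "has_leading_form d P g"
    and C: "\<And>a b. a \<in> A \<Longrightarrow> b \<in> B \<Longrightarrow> poly2 P a b \<noteq> 0 \<Longrightarrow> a + b \<in> C"
    and i: "i < card A" "Polynomial.coeff g i \<noteq> 0"
    and j: "j < card B" "j \<le> d" "Polynomial.coeff g (d - j) \<noteq> 0"
    and small: "CHAR('a) = 0 \<or> card C + closure_mult g (-1) < CHAR('a)"
  shows "card A + card B \<le> card C + 1 + d + N_max g"
proof (rule ccontr)
  assume not: "\<not> ?thesis"
  define n where "n = card C"
  define F where "F = [:1, 1:] ^ n * g"
  have "g \<noteq> 0" using i by auto
  have zero: "Polynomial.coeff F s = 0" if "s < card A" "s \<le> d + n" "d + n < s + card B" for s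
    unfolding F_def n_def
    by (rule restricted_sumset_imp_coeff_eq_0[OF fin lf C, where t = "d + n - s"])
       (use that in \<open>auto simp: n_def\<close>)
  define m where "m = (LEAST k. Polynomial.coeff g k \<noteq> 0)"
  have m: "Polynomial.coeff g m \<noteq> 0" "m \<le> i" "\<And>k. k < m \<Longrightarrow> Polynomial.coeff g k = 0"
    unfolding m_def using i(2) by (rule LeastI, rule Least_le) (auto dest: not_less_Least)
  have "Polynomial.coeff F m \<noteq> 0"
    unfolding F_def using m by (simp add: lowest_coeff_mult_power)
  moreover have "m \<le> d"
    using m(1) lf le_degree[of g m] by (simp add: has_leading_form_def)
  ultimately have low: "m + card B \<le> d + n"
    using zero[of m] m(2) i(1) by linarith
  have deg_F: "Polynomial.degree F = n + Polynomial.degree g"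
    unfolding F_def using \<open>g \<noteq> 0\<close> by (simp add: degree_mult_eq degree_power_eq)
  have "F \<noteq> 0" using \<open>Polynomial.coeff F m \<noteq> 0\<close> by auto
  moreover have "d - j \<le> Polynomial.degree g" using j(3) by (rule le_degree)
  moreover have "Polynomial.degree g \<le> d" using lf by (simp add: has_leading_form_def)
  ultimately have high: "card A \<le> Polynomial.degree F" and deg_F_le: "Polynomial.degree F \<le> d + n"
    using zero[of "Polynomial.degree F"] j(1,2) deg_F leading_coeff_0_iff[of F] by linarith+
  define f where "f = map_poly to_ac F"
  have coeff_f: "Polynomial.coeff f s = to_ac (Polynomial.coeff F s)" for s
    by (simp add: f_def coeff_map_poly)
  have "f \<noteq> 0"
    using \<open>F \<noteq> 0\<close> by (simp add: f_def map_poly_eq_0_iff)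
  obtain q where q: "q \<in> char_powers (field_characteristic TYPE('a alg_closure))"
    "card A - (d + n - card B) \<le> q * card {\<alpha>. \<alpha> \<noteq> 0 \<and> q \<le> Polynomial.order \<alpha> f}"
  proof (rule bexE[OF vanishing_coeffs_le_multiplicity_count[of "d + n - card B" "card A" f m "Polynomial.degree F"]])
    show "d + n - card B < card A" using not low i(1) by (simp add: n_def)
    show "Polynomial.coeff f s = 0" if "d + n - card B < s" "s < card A" for s
    proof (cases "s \<le> d + n")
      case True
      then show ?thesis using zero[of s] that low coeff_f by simp
    next
      case False
      then show ?thesis using deg_F_le by (simp add: coeff_f coeff_eq_0)
    qed
  qed (use low high m \<open>F \<noteq> 0\<close> \<open>Polynomial.coeff F m \<noteq> 0\<close> in \<open>auto simp: coeff_f\<close>)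
  let ?S = "{\<alpha>. \<alpha> \<noteq> 0 \<and> \<alpha> \<noteq> -1 \<and> q \<le> closure_mult g \<alpha>}"
  have q': "q \<in> char_powers (field_characteristic TYPE('a))"
    using q(1) unfolding field_characteristic_def CHAR_alg_closure .
  have N: "q * card ?S \<le> N_max g"
    unfolding N_max_def using q' by (intro Max_ge finite_N_max_set \<open>g \<noteq> 0\<close>) auto
  have ord: "Polynomial.order \<alpha> f = closure_mult g \<alpha> + (if \<alpha> = -1 then n else 0)" for \<alpha>
    using closure_mult_mult_power[OF \<open>g \<noteq> 0\<close>, of n \<alpha>] by (simp add: f_def F_def closure_mult_def)
  have finS: "finite ?S"
    by (rule finite_subset[OF _ finite_high_order[of f q]])
       (use char_powers_pos[OF q'] \<open>f \<noteq> 0\<close> in \<open>auto simp: ord\<close>)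
  have "q * card {\<alpha>. \<alpha> \<noteq> 0 \<and> q \<le> Polynomial.order \<alpha> f} \<le> N_max g + 1"
  proof (cases "q = 1")
    case True
    have "card {\<alpha>. \<alpha> \<noteq> 0 \<and> q \<le> Polynomial.order \<alpha> f} \<le> card (insert (-1) ?S)"
      using finS by (intro card_mono) (auto simp: ord)
    also have "\<dots> \<le> card ?S + 1" using finS by (simp add: card_insert_if)
    finally show ?thesis using N True by simp
  next
    case False
    then obtain e where e: "q = CHAR('a) ^ e" "CHAR('a) > 0"
      using q' by (auto simp: char_powers_def field_characteristic_def split: if_splits)
    then have "CHAR('a) \<le> q" using False by (cases e) simp_all
    then have "\<not> q \<le> Polynomial.order (-1) f" using small e(2) by (simp add: ord n_def)
    then have "{\<alpha>. \<alpha> \<noteq> 0 \<and> q \<le> Polynomial.order \<alpha> f} \<subseteq> ?S" by (auto simp: ord)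
    then have "card {\<alpha>. \<alpha> \<noteq> 0 \<and> q \<le> Polynomial.order \<alpha> f} \<le> card ?S"
      using finS by (rule card_mono[rotated])
    then show ?thesis using N by (meson le_trans mult_le_mono2 trans_le_add1)
  qed
  then show False using q(2) not low by (simp add: n_def)
qed

theorem theorem1:
  fixes A B C :: "'a::field set"
    and P P\<^sub>0 R :: "'a poly poly"
    and Pstar :: "'a poly"
    and d :: nat
    and i j :: int
  assumes "finite A" "A \<noteq> {}" "finite B" "B \<noteq> {}"
    and "total_degree P = int d"
    and "i \<in> {0..int (card A) - 1}" "j \<in> {0..int (card B) - 1}"
    and "coeff2 P i (int d - i) \<noteq> 0" "coeff2 P (int d - j) j \<noteq> 0"
    and "homogeneous2 d P\<^sub>0" "P = P\<^sub>0 + R" "total_degree R < int d"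
    and "Pstar = poly P\<^sub>0 1"
    and "C = {a + b | a b. a \<in> A \<and> b \<in> B \<and> poly2 P a b \<noteq> 0}"
  shows "ereal (real (card C)) \<ge>
    min (ereal_of_enat (field_characteristic TYPE('a)) - ereal (real (closure_mult Pstar (-1))))
        (ereal (real (card A) + real (card B) - 1 - real d - real (N_max Pstar)))"
proof -
  define n where "n = card C"
  define m where "m = closure_mult Pstar (-1)"
  have lf: "has_leading_form d P Pstar"
    unfolding \<open>Pstar = poly P\<^sub>0 1\<close> using assms(10-12) by (rule has_leading_formI)
  have "C \<subseteq> (\<lambda>(a, b). a + b) ` (A \<times> B)"
    unfolding assms(14) by auto
  then have "finite C"
    by (rule finite_subset) (use assms(1,3) in simp)
  have leading: "Polynomial.coeff Pstar (nat u) \<noteq> 0" "nat u + nat v = d"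
    if "coeff2 P u v \<noteq> 0" "u + v = int d" for u v
  proof -
    have "u \<ge> 0" "v \<ge> 0" "Polynomial.coeff (Polynomial.coeff P (nat v)) (nat u) \<noteq> 0"
      using that(1) by (auto simp: coeff2_def split: if_splits)
    moreover from this show "nat u + nat v = d" using that(2) by linarith
    ultimately show "Polynomial.coeff Pstar (nat u) \<noteq> 0"
      using lf by (simp add: has_leading_form_def)
  qed
  have bound: "card A + card B \<le> n + 1 + d + N_max Pstar" if "CHAR('a) = 0 \<or> n + m < CHAR('a)"
    unfolding n_def
  proof (rule card_restricted_sumset_ge[OF assms(1,3) \<open>finite C\<close> lf, of "nat i" "nat j"])
    show "a + b \<in> C" if "a \<in> A" "b \<in> B" "poly2 P a b \<noteq> 0" for a b
      using that assms(14) by blast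
    show "nat i < card A" "nat j < card B" using assms(6,7) by auto
    show "Polynomial.coeff Pstar (nat i) \<noteq> 0" using leading(1)[OF assms(8)] by simp
    have "nat (int d - j) + nat j = d" using leading(2)[OF assms(9)] by simp
    then have "nat (int d - j) = d - nat j" "nat j \<le> d" by linarith+
    then show "nat j \<le> d" "Polynomial.coeff Pstar (d - nat j) \<noteq> 0"
      using leading(1)[OF assms(9)] by simp_all
  qed (use that in \<open>simp add: n_def m_def\<close>)
  show ?thesis
  proof (cases "CHAR('a) = 0 \<or> n + m < CHAR('a)")
    case True
    then have "real (card A) + real (card B) - 1 - real d - real (N_max Pstar) \<le> real n"
      using bound by linarith
    then show ?thesis
      unfolding n_def[symmetric] by (intro min.coboundedI2) simp
  next
    case False
    then have "ereal_of_enat (field_characteristic TYPE('a)) - ereal (real m) \<le> ereal (real n)"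
      by (simp add: field_characteristic_def)
    then show ?thesis
      unfolding n_def[symmetric] m_def[symmetric] by (intro min.coboundedI1)
  qed
qed

end
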